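(* Let $\mathcal F_{\Delta t}$ be an extended phase space symplectic integrator on $\mathbb{R}^{4(L-1)}\ni(Q,X,P,Y)$ for the extended spatially semi-discretized stochastic cubic Schrödinger equation, i.e. a one-step map which almost surely preserves $\mathrm{d}Q\wedge \mathrm{d}P+\mathrm{d}X\wedge \mathrm{d}Y$ (in particular, $\mathcal F_{\Delta t}=\mathcal F^a_{\Delta t/2}\star\mathcal F^b_{\Delta t}\star\mathcal F^a_{\Delta t/2}$). Then the full discretization $\widetilde{\mathcal F}_{\Delta t}:(Q^n,P^n,B^n,\Theta^n)\mapsto(Q^{n+1},P^{n+1},B^{n+1},\Theta^{n+1})$ obtained from $\mathcal F_{\Delta t}$ by symmetric projection preserves the stochastic multi-symplectic conservation law, i.e. for $n\in\{0,1,\ldots,N-1\}$, $$\begin{aligned} &\mathrm{d}Q^{n+1}\wedge \mathrm{d}P^{n+1}+\Delta t\big(\mathrm{d}Q^{n+1}\wedge D^+\mathrm{d}B^{n+1}+\mathrm{d}P^{n+1}\wedge D^+\mathrm{d}\Theta^{n+1}+D^-\mathrm{d}Q^{n+1}\wedge \mathrm{d}B^{n+1}+D^-\mathrm{d}P^{n+1}\wedge \mathrm{d}\Theta^{n+1}\big)\\ =\;&\mathrm{d}Q^{n}\wedge \mathrm{d}P^{n}+\Delta t\big(\mathrm{d}Q^{n}\wedge D^+\mathrm{d}B^{n}+\mathrm{d}P^{n}\wedge D^+\mathrm{d}\Theta^{n}+D^-\mathrm{d}Q^{n}\wedge \mathrm{d}B^{n}+D^-\mathrm{d}P^{n}\wedge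 \mathrm{d}\Theta^{n}\big)\quad\text{a.s.} \end{aligned}$$
   Context: **Equation.** The stochastic cubic Schrödinger equation is $\mathbf i\,du+u_{xx}dt+|u|^2u\,dt=u\circ dW(t)$, $u(0)=u_0$, $t\in(0,T)$, on a bounded interval with homogeneous Dirichlet boundary condition, with $u=p+\mathbf i q$ and $W$ a $\mathbf Q$-Wiener process with (truncated) expansion $\sum_{k=1}^M\sqrt{\lambda_k}\,e_k\beta_k(t)$, $\beta_k$ independent Brownian motions. **Spatial discretization.** Let $L\ge2$ be an integer, $x_0<x_1<\dots<x_L$ a uniform grid of the interval with step $h$. Let $D^+,D^-\in\mathbb{R}^{(L-1)\times(L-1)}$: $D^+$ has diagonal entries $-1/h$, first superdiagonal entries $1/h$, and zeros elsewhere; $D^-$ has diagonal entries $1/h$, first subdiagonal entries $-1/h$, and zeros elsewhere. Let $\boldsymbol\Lambda=\mathrm{diag}(\sqrt{\lambda_1},\dots,\sqrt{\lambda_M})$, $\boldsymbol\beta=(\beta_1,\dots,\beta_M)^\top$, $\mathbf E=(e_k(x_i))_{1\le i\le L-1,\,1\le k\le M}$. With $P_i\approx p(x_i,\cdot)$, $Q_i\approx q(x_i,\cdot)$, $\Theta=D^-P$, $B=D^-Q$, the semi-discretization is $$dQ=D^+\Theta dt+(\mathrm{diag}(P)^2+\mathrm{diag}(Q)^2)P\,dt-\mathrm{diag}(P)\mathbf E\boldsymbol\Lambda\circ d\boldsymbol\beta,\quad dP=-D^+B\,dt-(\mathrm{diag}(P)^2+\mathrm{diag}(Q)^2)Q\,dt+\mathrm{diag}(Q)\mathbf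 E\boldsymbol\Lambda\circ d\boldsymbol\beta .$$ **Extended system.** On $(Q,X,P,Y)\in\mathbb{R}^{4(L-1)}$: $$\begin{aligned} dQ&=D^+D^-P\,dt+(\mathrm{diag}(P)^2+\mathrm{diag}(X)^2)P\,dt-\mathrm{diag}(P)\mathbf E\boldsymbol\Lambda\circ d\boldsymbol\beta,\\ dX&=D^+D^-Y\,dt+(\mathrm{diag}(Y)^2+\mathrm{diag}(Q)^2)Y\,dt-\mathrm{diag}(Y)\mathbf E\boldsymbol\Lambda\circ d\boldsymbol\beta,\\ dP&=-D^+D^-Q\,dt-(\mathrm{diag}(Q)^2+\mathrm{diag}(Y)^2)Q\,dt+\mathrm{diag}(Q)\mathbf E\boldsymbol\Lambda\circ d\boldsymbol\beta,\\ dY&=-D^+D^-X\,dt-(\mathrm{diag}(X)^2+\mathrm{diag}(P)^2)X\,dt+\mathrm{diag}(X)\mathbf E\boldsymbol\Lambda\circ d\boldsymbol\beta. \end{aligned}$$ $\mathcal F^a$ is the flow of the subsystem consisting of the $X$- and $P$-equations with $dQ=dY=0$; $\mathcal F^b$ is the flow of the subsystem consisting of the $Q$- and $Y$-equations with $dX=dP=0$. Over a subinterval of length $\tau$ with Brownian increment $\delta\boldsymbol\beta$ they are explicit: $\mathcal F^a$ keeps $Q,Y$ fixed and maps $$P\mapsto P-\tau\big(D^+D^-Q+(\mathrm{diag}(Q)^2+\mathrm{diag}(Y)^2)Q\big)+\mathrm{diag}(Q)\mathbf E\boldsymbol\Lambda\delta\boldsymbol\beta,\quad X\mapsto X+\tau\big(D^+D^-Y+(\mathrm{diag}(Q)^2+\mathrm{diag}(Y)^2)Y\big)-\mathrm{diag}(Y)\mathbf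 E\boldsymbol\Lambda\delta\boldsymbol\beta;$$ $\mathcal F^b$ keeps $P,X$ fixed and maps $$Q\mapsto Q+\tau\big(D^+D^-P+(\mathrm{diag}(P)^2+\mathrm{diag}(X)^2)P\big)-\mathrm{diag}(P)\mathbf E\boldsymbol\Lambda\delta\boldsymbol\beta,\quad Y\mapsto Y-\tau\big(D^+D^-X+(\mathrm{diag}(P)^2+\mathrm{diag}(X)^2)X\big)+\mathrm{diag}(X)\mathbf E\boldsymbol\Lambda\delta\boldsymbol\beta.$$ $\star$ denotes composition, leftmost factor applied first. On $[t_n,t_{n+1}]$ ($t_n=n\Delta t$, $\Delta t=T/N$), in $\mathcal F^a_{\Delta t/2}\star\mathcal F^b_{\Delta t}\star\mathcal F^a_{\Delta t/2}$ the first factor has $\tau=\frac{\Delta t}2$ and increment $\boldsymbol\beta(t_n+\frac{\Delta t}2)-\boldsymbol\beta(t_n)$, the middle one $\tau=\Delta t$ and $\boldsymbol\beta(t_{n+1})-\boldsymbol\beta(t_n)$, the last one $\tau=\frac{\Delta t}2$ and $\boldsymbol\beta(t_{n+1})-\boldsymbol\beta(t_n+\frac{\Delta t}2)$. **Full discretization (symmetric projection).** Let $A=\begin{bmatrix}I_{L-1}&-I_{L-1}&0&0\\0&0&I_{L-1}&-I_{L-1}\end{bmatrix}$, $\mathcal N=\ker A$. Given $(Q^n,P^n,B^n,\Theta^n)$ with $B^n=D^-Q^n$, $\Theta^n=D^-P^n$, set $Z^n=((Q^n)^\top,(Q^n)^\top,(P^n)^\top,(P^n)^\top)^\top\in\mathcal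 N$ and let $\lambda\in\mathbb{R}^{2(L-1)}$ be determined by requiring $$Z^{n+1}:=\mathcal F_{\Delta t}(Z^n+A^\top\lambda)+A^\top\lambda\in\mathcal N .$$ Then $Z^{n+1}=((Q^{n+1})^\top,(Q^{n+1})^\top,(P^{n+1})^\top,(P^{n+1})^\top)^\top$ defines $Q^{n+1},P^{n+1}$, and $B^{n+1}:=D^-Q^{n+1}$, $\Theta^{n+1}:=D^-P^{n+1}$. It is understood that $\mathcal F_{\Delta t}$ is smooth for each realization of the noise and that $\Delta t$ is small enough that $\lambda$ is the local solution near $0$ given by the implicit function theorem, depending smoothly on $Z^n$. **Notation.** $\mathrm{d}$ in wedge products is the exterior differential in phase space (with respect to the initial value) for a fixed realization of the noise; for vector-valued $u,v$, $\mathrm{d}u\wedge \mathrm{d}v=\sum_i \mathrm{d}u_i\wedge \mathrm{d}v_i$, and matrices act on the vector of differentials, e.g. $\mathrm{d}u\wedge D^+\mathrm{d}v=\sum_{i,j}D^+_{ij}\,\mathrm{d}u_i\wedge \mathrm{d}v_j$. *)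

theory Defs
  imports "HOL-Analysis.Analysis" "HOL-Probability.Probability"
begin

section \<open>Brownian motions\<close>

definition brownian_motion :: "'w measure \<Rightarrow> (real \<Rightarrow> 'w \<Rightarrow> real) \<Rightarrow> bool" where
  "brownian_motion M B \<longleftrightarrow>
     prob_space M \<and>
     (\<forall>t\<ge>0. B t \<in> borel_measurable M) \<and>
     (AE \<omega> in M. B 0 \<omega> = 0) \<and>
     (\<forall>(n::nat) t. 0 \<le> t 0 \<and> (\<forall>i<n. t i \<le> t (Suc i)) \<longrightarrow>
        prob_space.indep_vars M (\<lambda>_. borel) (\<lambda>i \<omega>. B (t (Suc i)) \<omega> - B (t i) \<omega>) {..<n}) \<and>
     (\<forall>s t. 0 \<le> s \<and> s < t \<longrightarrow>
        distributed M lborel (\<lambda>\<omega>. B t \<omega> - B s \<omega>) (normal_density 0 (sqrt (t - s)))) \<and>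
     (AE \<omega> in M. continuous_on {0..} (\<lambda>t. B t \<omega>))"

text \<open>Independence of the family is independence of the whole paths, as random variables
  in the product space over the time set.\<close>

definition independent_brownian_motions ::
    "'w measure \<Rightarrow> ('k \<Rightarrow> real \<Rightarrow> 'w \<Rightarrow> real) \<Rightarrow> bool" where
  "independent_brownian_motions M \<beta> \<longleftrightarrow>
     (\<forall>k. brownian_motion M (\<beta> k)) \<and>
     prob_space.indep_vars M (\<lambda>_. Pi\<^sub>M {0..} (\<lambda>_. borel))
       (\<lambda>k \<omega>. \<lambda>t\<in>{0..}. \<beta> k t \<omega>) UNIV"


section \<open>Smooth maps, differentials and wedge products\<close>

text \<open>\<open>ck_on k S f\<close>: \<open>f\<close> is \<open>k\<close> times continuously differentiable on \<open>S\<close>. It is meant for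
  open \<open>S\<close> in a finite-dimensional space, where continuity of all iterated directional
  derivatives is the usual notion.\<close>

primrec ck_on ::
    "nat \<Rightarrow> 'a::real_normed_vector set \<Rightarrow> ('a \<Rightarrow> 'b::real_normed_vector) \<Rightarrow> bool" where
  "ck_on 0 S f \<longleftrightarrow> continuous_on S f"
| "ck_on (Suc k) S f \<longleftrightarrow>
     (\<forall>x\<in>S. f differentiable (at x)) \<and>
     (\<forall>v. ck_on k S (\<lambda>x. frechet_derivative f (at x) v))"

definition smooth_on :: "'a::real_normed_vector set \<Rightarrow> ('a \<Rightarrow> 'b::real_normed_vector) \<Rightarrow> bool" where
  "smooth_on S f \<longleftrightarrow> (\<forall>k. ck_on k S f)"

text \<open>The differential at \<open>z\<close> of a vector-valued function is the vector of the differentials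
  of its components, i.e. a vector-valued one-form, here a map from tangent vectors to
  vectors. It is only meaningful where the function is differentiable.\<close>

definition extd :: "('a::real_normed_vector \<Rightarrow> real ^ 'm) \<Rightarrow> 'a \<Rightarrow> 'a \<Rightarrow> real ^ 'm" where
  "extd f z = frechet_derivative f (at z)"

definition wedge :: "('a \<Rightarrow> real ^ 'm) \<Rightarrow> ('a \<Rightarrow> real ^ 'm) \<Rightarrow> 'a \<Rightarrow> 'a \<Rightarrow> real" where
  "wedge \<alpha> \<beta> v w = (\<Sum>i\<in>UNIV. \<alpha> v $ i * \<beta> w $ i - \<alpha> w $ i * \<beta> v $ i)"

definition mat_form :: "real ^ 'm ^ 'l \<Rightarrow> ('a \<Rightarrow> real ^ 'm) \<Rightarrow> 'a \<Rightarrow> real ^ 'l" where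
  "mat_form A \<alpha> v = A *v \<alpha> v"


section \<open>Spatial discretization\<close>

text \<open>Grid functions on the \<open>L - 1\<close> interior grid points are vectors over a finite linearly
  ordered type \<open>'m\<close> with \<open>L - 1\<close> elements; \<open>pos i\<close> is the number in \<open>{1..L-1}\<close> of the
  index \<open>i\<close>.\<close>

definition pos :: "'m::{finite,linorder} \<Rightarrow> nat" where
  "pos i = card {j. j \<le> i}"

definition Dplus :: "real \<Rightarrow> real ^ ('m::{finite,linorder}) ^ ('m::{finite,linorder})" where
  "Dplus h = (\<chi> i j. if j = i then - 1 / h else if pos j = pos i + 1 then 1 / h else 0)"

definition Dminus :: "real \<Rightarrow> real ^ ('m::{finite,linorder}) ^ ('m::{finite,linorder})" where
  "Dminus h = (\<chi> i j. if j = i then 1 / h else if pos i = pos j + 1 then - 1 / h else 0)"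

definition diag :: "real ^ 'm \<Rightarrow> real ^ 'm ^ 'm" where
  "diag v = (\<chi> i j. if i = j then v $ i else 0)"

definition E_mat ::
    "real \<Rightarrow> real \<Rightarrow> ('k \<Rightarrow> real \<Rightarrow> real) \<Rightarrow> real ^ 'k ^ ('m::{finite,linorder})" where
  "E_mat a h e = (\<chi> i k. e k (a + real (pos i) * h))"

definition Lambda_mat :: "('k \<Rightarrow> real) \<Rightarrow> real ^ 'k ^ 'k" where
  "Lambda_mat ew = diag (\<chi> k. sqrt (ew k))"


section \<open>The extended phase space\<close>

text \<open>Elements are quadruples \<open>(Q, X, P, Y)\<close>.\<close>

type_synonym 'm ext = "(real ^ 'm) \<times> (real ^ 'm) \<times> (real ^ 'm) \<times> (real ^ 'm)"

definition extended_form ::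
    "('a::real_normed_vector \<Rightarrow> 'm::finite ext) \<Rightarrow> 'a \<Rightarrow> 'a \<Rightarrow> 'a \<Rightarrow> real" where
  "extended_form f z v w =
     wedge (extd (\<lambda>y. fst (f y)) z) (extd (\<lambda>y. fst (snd (snd (f y)))) z) v w +
     wedge (extd (\<lambda>y. fst (snd (f y))) z) (extd (\<lambda>y. snd (snd (snd (f y)))) z) v w"

definition symplectic_map :: "('m::finite ext \<Rightarrow> 'm ext) \<Rightarrow> bool" where
  "symplectic_map f \<longleftrightarrow> (\<forall>z v w. extended_form f z v w = extended_form (\<lambda>y. y) z v w)"

text \<open>\<open>F n \<omega>\<close> is the one-step map on the \<open>n\<close>-th subinterval for the realization \<open>\<omega>\<close>.\<close>

definition symplectic_integrator ::
    "'w measure \<Rightarrow> nat \<Rightarrow> (nat \<Rightarrow> 'w \<Rightarrow> 'm::finite ext \<Rightarrow> 'm ext) \<Rightarrow> bool" where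
  "symplectic_integrator M N F \<longleftrightarrow>
     (\<forall>n<N. \<forall>\<omega>\<in>space M. smooth_on UNIV (F n \<omega>)) \<and>
     (AE \<omega> in M. \<forall>n<N. symplectic_map (F n \<omega>))"

text \<open>The flows \<open>Fa\<close> and \<open>Fb\<close> of the two subsystems of the extended system; \<open>G\<close> is the
  matrix \<open>E \<Lambda>\<close>, \<open>\<tau>\<close> the length of the subinterval and \<open>\<delta>\<close> the Brownian increment.\<close>

fun Fa :: "real \<Rightarrow> real ^ 'k ^ ('m::{finite,linorder}) \<Rightarrow> real \<Rightarrow> real ^ 'k
           \<Rightarrow> 'm::{finite,linorder} ext \<Rightarrow> 'm ext" where
  "Fa h G \<tau> \<delta> (Q, X, P, Y) =
     (Q,
      X + \<tau> *\<^sub>R ((Dplus h ** Dminus h) *v Y + (diag Q ** diag Q + diag Y ** diag Y) *v Y)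
        - (diag Y ** G) *v \<delta>,
      P - \<tau> *\<^sub>R ((Dplus h ** Dminus h) *v Q + (diag Q ** diag Q + diag Y ** diag Y) *v Q)
        + (diag Q ** G) *v \<delta>,
      Y)"

fun Fb :: "real \<Rightarrow> real ^ 'k ^ ('m::{finite,linorder}) \<Rightarrow> real \<Rightarrow> real ^ 'k
           \<Rightarrow> 'm::{finite,linorder} ext \<Rightarrow> 'm ext" where
  "Fb h G \<tau> \<delta> (Q, X, P, Y) =
     (Q + \<tau> *\<^sub>R ((Dplus h ** Dminus h) *v P + (diag P ** diag P + diag X ** diag X) *v P)
        - (diag P ** G) *v \<delta>,
      X,
      P,
      Y - \<tau> *\<^sub>R ((Dplus h ** Dminus h) *v X + (diag P ** diag P + diag X ** diag X) *v X)
        + (diag X ** G) *v \<delta>)"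

definition splitting ::
    "real \<Rightarrow> real ^ 'k ^ ('m::{finite,linorder}) \<Rightarrow> ('k \<Rightarrow> real \<Rightarrow> 'w \<Rightarrow> real) \<Rightarrow> real
     \<Rightarrow> nat \<Rightarrow> 'w \<Rightarrow> 'm::{finite,linorder} ext \<Rightarrow> 'm ext" where
  "splitting h G \<beta> dt n \<omega> z =
     (let b = (\<lambda>t. \<chi> k. \<beta> k t \<omega>);
          t0 = real n * dt;
          t1 = real (Suc n) * dt
      in Fa h G (dt / 2) (b t1 - b (t0 + dt / 2))
           (Fb h G dt (b t1 - b t0)
             (Fa h G (dt / 2) (b (t0 + dt / 2) - b t0) z)))"


section \<open>Symmetric projection\<close>

type_synonym 'm phase = "(real ^ 'm) \<times> (real ^ 'm)"

fun A_map :: "'m::finite ext \<Rightarrow> 'm phase" where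
  "A_map (Q, X, P, Y) = (Q - X, P - Y)"

definition N_space :: "'m::finite ext set" where
  "N_space = {z. A_map z = 0}"

fun dup :: "'m::finite phase \<Rightarrow> 'm ext" where
  "dup (Q, P) = (Q, Q, P, P)"

text \<open>\<open>adjoint A_map\<close> is the transpose of \<open>A\<close>.\<close>

definition projected ::
    "('m::finite ext \<Rightarrow> 'm ext) \<Rightarrow> 'm phase \<Rightarrow> 'm phase \<Rightarrow> 'm ext" where
  "projected F u \<mu> = F (dup u + adjoint A_map \<mu>) + adjoint A_map \<mu>"

text \<open>The multiplier is the smooth local solution branch near \<open>0\<close> provided by the implicit
  function theorem: on the open set \<open>S\<close> of states \<open>(Q, P)\<close>, \<open>lam (Q, P)\<close> is the only
  solution in a ball around \<open>0\<close>. The states at which there is no such solution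
  (the step size is too large for the given realization of the noise) are left outside \<open>S\<close>.\<close>

definition local_multiplier ::
    "('m::finite ext \<Rightarrow> 'm ext) \<Rightarrow> 'm phase set \<Rightarrow> ('m phase \<Rightarrow> 'm phase) \<Rightarrow> bool" where
  "local_multiplier F S lam \<longleftrightarrow>
     open S \<and> smooth_on S lam \<and>
     (\<exists>r>0. \<forall>u\<in>S. lam u \<in> ball 0 r \<and>
        (\<forall>\<mu>\<in>ball 0 r. projected F u \<mu> \<in> N_space \<longleftrightarrow> \<mu> = lam u))"

text \<open>States of the full discretization are quadruples \<open>(Q, P, B, \<Theta>)\<close>.\<close>

type_synonym 'm full = "(real ^ 'm) \<times> (real ^ 'm) \<times> (real ^ 'm) \<times> (real ^ 'm)"

fun initial_state :: "real \<Rightarrow> 'm::{finite,linorder} phase \<Rightarrow> 'm full" where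
  "initial_state h (Q, P) = (Q, P, Dminus h *v Q, Dminus h *v P)"

fun projection_step ::
    "real \<Rightarrow> ('m::{finite,linorder} ext \<Rightarrow> 'm ext) \<Rightarrow> ('m phase \<Rightarrow> 'm phase)
     \<Rightarrow> 'm full \<Rightarrow> 'm full" where
  "projection_step h F lam (Q, P, B, \<Theta>) =
     (let Z = projected F (Q, P) (lam (Q, P));
          Q' = fst Z;
          P' = fst (snd (snd Z))
      in (Q', P', Dminus h *v Q', Dminus h *v P'))"

text \<open>The numerical solution after \<open>n\<close> steps, as a function of the initial value \<open>(Q, P)\<close>.\<close>

primrec numerical_solution ::
    "real \<Rightarrow> (nat \<Rightarrow> 'm::{finite,linorder} ext \<Rightarrow> 'm ext) \<Rightarrow> (nat \<Rightarrow> 'm phase \<Rightarrow> 'm phase)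
     \<Rightarrow> nat \<Rightarrow> 'm phase \<Rightarrow> 'm full" where
  "numerical_solution h F lam 0 u = initial_state h u"
| "numerical_solution h F lam (Suc n) u =
     projection_step h (F n) (lam n) (numerical_solution h F lam n u)"

fun QP :: "'m::finite full \<Rightarrow> 'm phase" where
  "QP (Q, P, B, \<Theta>) = (Q, P)"

definition multisymplectic_form ::
    "real \<Rightarrow> real \<Rightarrow> ('a::real_normed_vector \<Rightarrow> 'm::{finite,linorder} full)
     \<Rightarrow> 'a \<Rightarrow> 'a \<Rightarrow> 'a \<Rightarrow> real" where
  "multisymplectic_form h dt f u v w =
     (let dQ = extd (\<lambda>y. fst (f y)) u;
          dP = extd (\<lambda>y. fst (snd (f y))) u;
          dB = extd (\<lambda>y. fst (snd (snd (f y)))) u;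
          d\<Theta> = extd (\<lambda>y. snd (snd (snd (f y)))) u
      in wedge dQ dP v w +
         dt * (wedge dQ (mat_form (Dplus h) dB) v w +
               wedge dP (mat_form (Dplus h) d\<Theta>) v w +
               wedge (mat_form (Dminus h) dQ) dB v w +
               wedge (mat_form (Dminus h) dP) d\<Theta> v w))"

end

theory Submission imports Defs begin

text \<open>The terms with the factor \<open>dt\<close> vanish. Since \<open>Dplus\<close> is minus
  the transpose of \<open>Dminus\<close>, the operator \<open>Dplus ** Dminus\<close> is symmetric,
  so dQ \<and> \<open>Dplus\<close> dB = 0 when B = \<open>Dminus\<close> Q; and
  \<open>Dminus\<close> dQ \<and> dB = dB \<and> dB = 0. The same holds for P and \<Theta>, so the
  law reduces to preservation of dQ \<and> dP (\<open>multisymplectic_form_initial_state\<close>).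

  For that, write a projected step from u to u' as F(\<open>dup\<close> u + \<open>A\<^sup>T\<close>
  \<lambda>) = \<open>dup\<close> u' - \<open>A\<^sup>T\<close> \<lambda>. On vectors
  \<open>dup\<close> u + \<open>A\<^sup>T\<close> \<mu> the extended form splits, without cross
  terms, into twice dQ \<and> dP of u and twice the same form of \<mu>
  (\<open>canonical_form_projection\<close>), and the latter does not see the sign of \<mu>. Hence
  the multiplier contributes equally on both sides of the symplecticity of F and cancels
  (\<open>phase_step_symplectic\<close>). The chain rule transports this to the initial value
  (\<open>multisymplectic_form_Suc\<close>).

  The splitting is a composition of shears along gradients. Symmetry of the Hessian
  (\<open>inner_force_derivative\<close>) makes each shear symplectic, and polynomiality makes it
  smooth.\<close>

section \<open>Wedge products and difference operators as inner products\<close>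

lemma wedge_inner: "wedge \<alpha> \<beta> v w = \<alpha> v \<bullet> \<beta> w - \<alpha> w \<bullet> \<beta> v"
  by (simp add: wedge_def inner_vec_def sum_subtractf)

lemma extd_eq: "(f has_derivative f') (at z) \<Longrightarrow> extd f z = f'"
  by (simp add: extd_def frechet_derivative_at[symmetric])

lemma Dplus_eq: "Dplus h = - transpose (Dminus h)"
  by (simp add: vec_eq_iff Dplus_def Dminus_def transpose_def)

lemma inner_Dplus: "x \<bullet> (Dplus h *v y) = - ((Dminus h *v x) \<bullet> y)"
proof -
  have "Dplus h *v y = - (transpose (Dminus h) *v y)"
    by (simp add: Dplus_eq vec_eq_iff matrix_vector_mult_def sum_negf)
  then show ?thesis
    by (metis dot_lmul_matrix inner_commute inner_minus_right transpose_matrix_vector)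
qed

text \<open>Discrete summation by parts; the right side is visibly symmetric in \<open>x\<close> and
  \<open>y\<close>.\<close>

lemma inner_laplacian: "x \<bullet> ((Dplus h ** Dminus h) *v y) = - ((Dminus h *v x) \<bullet> (Dminus h *v y))"
  by (simp add: inner_Dplus flip: matrix_vector_mul_assoc)

section \<open>The canonical two-form and its pullbacks\<close>

fun canonical_form :: "'m::finite ext \<Rightarrow> 'm ext \<Rightarrow> real" where
  "canonical_form (q, x, p, y) (q', x', p', y') = q \<bullet> p' - q' \<bullet> p + (x \<bullet> y' - x' \<bullet> y)"

lemma canonical_form_alt:
  "canonical_form v w = fst v \<bullet> fst (snd (snd w)) - fst w \<bullet> fst (snd (snd v)) +
     (fst (snd v) \<bullet> snd (snd (snd w)) - fst (snd w) \<bullet> snd (snd (snd v)))"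
  by (cases v; cases w) simp

lemma extended_form_eq:
  assumes "(f has_derivative f') (at z)"
  shows "extended_form f z v w = canonical_form (f' v) (f' w)"
proof -
  note d = has_derivative_fst has_derivative_snd
  show ?thesis
    unfolding extended_form_def wedge_inner canonical_form_alt
    by (simp add: extd_eq[OF d(1)[OF assms]] extd_eq[OF d(1)[OF d(2)[OF assms]]]
        extd_eq[OF d(1)[OF d(2)[OF d(2)[OF assms]]]] extd_eq[OF d(2)[OF d(2)[OF d(2)[OF assms]]]])
qed

lemma symplectic_map_derivative:
  assumes "symplectic_map f" "(f has_derivative f') (at z)"
  shows "canonical_form (f' v) (f' w) = canonical_form v w"
  using assms(1) extended_form_eq[OF assms(2)] extended_form_eq[OF has_derivative_ident]
  unfolding symplectic_map_def by metis

lemma symplectic_mapI: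
  assumes "\<And>z. (f has_derivative f' z) (at z)"
    and "\<And>z v w. canonical_form (f' z v) (f' z w) = canonical_form v w"
  shows "symplectic_map f"
  unfolding symplectic_map_def
  by (simp add: extended_form_eq[OF assms(1)] extended_form_eq[OF has_derivative_ident] assms(2))

text \<open>This is the chain rule. Differentiability is required because
  \<open>symplectic_map\<close> speaks of \<open>frechet_derivative\<close>, which is a true
  derivative only where one exists.\<close>

lemma symplectic_map_compose:
  assumes "symplectic_map f" "symplectic_map g"
    and "\<And>z. f differentiable (at z)" "\<And>z. g differentiable (at z)"
  shows "symplectic_map (\<lambda>z. f (g z))"
proof -
  have df: "(f has_derivative frechet_derivative f (at z)) (at z)" for z
    using assms(3) frechet_derivative_works by blast
  have dg: "(g has_derivative frechet_derivative g (at z)) (at z)" for z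
    using assms(4) frechet_derivative_works by blast
  show ?thesis
    by (rule symplectic_mapI[OF has_derivative_compose[OF dg df]])
      (simp add: symplectic_map_derivative[OF assms(1) df] symplectic_map_derivative[OF assms(2) dg])
qed

section \<open>Polynomial maps are smooth\<close>

lemma real_polynomial_function_frechet_derivative:
  fixes f :: "'a::euclidean_space \<Rightarrow> real"
  assumes "real_polynomial_function f"
  shows "real_polynomial_function (\<lambda>x. frechet_derivative f (at x) v)"
  using assms
proof (induction f)
  case (linear f)
  then have "frechet_derivative f (at x) = f" for x
    using bounded_linear_imp_has_derivative frechet_derivative_at by metis
  then show ?case by (simp add: real_polynomial_function.intros(2))
next
  case (const c)
  show ?case by (simp add: real_polynomial_function.intros(2))
next
  case (add f g)
  then have d: "(f has_derivative frechet_derivative f (at x)) (at x)"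
    "(g has_derivative frechet_derivative g (at x)) (at x)" for x
    by (simp_all add: differentiable_at_real_polynomial_function flip: frechet_derivative_works)
  have "frechet_derivative (\<lambda>x. f x + g x) (at x) v =
      frechet_derivative f (at x) v + frechet_derivative g (at x) v" for x
    by (simp flip: frechet_derivative_at[OF has_derivative_add[OF d]])
  then show ?case using add by (simp add: real_polynomial_function.intros(3))
next
  case (mult f g)
  then have d: "(f has_derivative frechet_derivative f (at x)) (at x)"
    "(g has_derivative frechet_derivative g (at x)) (at x)" for x
    by (simp_all add: differentiable_at_real_polynomial_function flip: frechet_derivative_works)
  have "frechet_derivative (\<lambda>x. f x * g x) (at x) v =
      f x * frechet_derivative g (at x) v + frechet_derivative f (at x) v * g x" for x
    by (simp flip: frechet_derivative_at[OF has_derivative_mult[OF d]])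
  then show ?case using mult by (simp add: real_polynomial_function.intros(3) real_polynomial_function.intros(4))
qed

text \<open>Polynomiality of a vector-valued map is tested by linear functionals, and these commute
  with differentiation, so the scalar case suffices.\<close>

lemma polynomial_function_frechet_derivative:
  fixes f :: "'a::euclidean_space \<Rightarrow> 'b::euclidean_space"
  assumes "polynomial_function f"
  shows "polynomial_function (\<lambda>x. frechet_derivative f (at x) v)"
  unfolding polynomial_function_def o_def
proof (intro allI impI)
  fix l :: "'b \<Rightarrow> real" assume l: "bounded_linear l"
  have "frechet_derivative (\<lambda>x. l (f x)) (at x) = (\<lambda>v. l (frechet_derivative f (at x) v))" for x
  proof -
    have "(f has_derivative frechet_derivative f (at x)) (at x)"
      using assms differentiable_at_polynomial_function frechet_derivative_works by blast
    from bounded_linear.has_derivative[OF l this] show ?thesis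
      by (rule frechet_derivative_at[symmetric])
  qed
  moreover have "real_polynomial_function (\<lambda>x. l (f x))"
    using assms l by (simp add: polynomial_function_def o_def)
  ultimately show "real_polynomial_function (\<lambda>x. l (frechet_derivative f (at x) v))"
    using real_polynomial_function_frechet_derivative[of "\<lambda>x. l (f x)" v] by simp
qed

text \<open>\<open>ck_on\<close> asks only for iterated directional derivatives, and the class of
  polynomial maps is closed under taking these.\<close>

lemma smooth_on_polynomial_function:
  fixes f :: "'a::euclidean_space \<Rightarrow> 'b::euclidean_space"
  assumes "polynomial_function f"
  shows "smooth_on S f"
  unfolding smooth_on_def
proof
  fix k show "ck_on k S f"
    using assms
    by (induction k arbitrary: f)
      (auto simp: continuous_on_polymonial_function differentiable_at_polynomial_function
        polynomial_function_frechet_derivative)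
qed

text \<open>A linear functional on a product is the sum of its restrictions to the two
  factors.\<close>

lemma polynomial_function_Pair:
  fixes f :: "'a::real_normed_vector \<Rightarrow> 'b::real_normed_vector"
    and g :: "'a \<Rightarrow> 'c::real_normed_vector"
  assumes "polynomial_function f" "polynomial_function g"
  shows "polynomial_function (\<lambda>x. (f x, g x))"
  unfolding polynomial_function_def o_def
proof (intro allI impI)
  fix l :: "'b \<times> 'c \<Rightarrow> real" assume l: "bounded_linear l"
  have "real_polynomial_function (\<lambda>x. l (f x, 0))" "real_polynomial_function (\<lambda>x. l (0, g x))"
    using assms
      bounded_linear_compose[OF l bounded_linear_Pair[OF bounded_linear_ident bounded_linear_zero]]
      bounded_linear_compose[OF l bounded_linear_Pair[OF bounded_linear_zero bounded_linear_ident]]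
    by (auto simp: polynomial_function_def o_def)
  moreover have "l (f x, g x) = l (f x, 0) + l (0, g x)" for x
    using linear_add[OF bounded_linear.linear[OF l], of "(f x, 0)" "(0, g x)"] by simp
  ultimately show "real_polynomial_function (\<lambda>x. l (f x, g x))"
    by (simp add: real_polynomial_function.intros(3))
qed

lemma polynomial_function_linear_compose:
  assumes "bounded_linear l" "polynomial_function f"
  shows "polynomial_function (\<lambda>x. l (f x))"
  using polynomial_function_compose[OF assms(2) polynomial_function_bounded_linear[OF assms(1)]]
  by (simp add: o_def)

lemma polynomial_function_vec_times:
  fixes f g :: "'a::real_normed_vector \<Rightarrow> real ^ 'm"
  assumes "polynomial_function f" "polynomial_function g"
  shows "polynomial_function (\<lambda>x. f x * g x)"
proof -
  \<comment> \<open>Expanding in the standard basis turns the componentwise product into a sum of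
    scalar polynomials times constant vectors.\<close>
  have "f x * g x = (\<Sum>i\<in>UNIV. (f x $ i * g x $ i) *\<^sub>R axis i 1)" for x
    by (simp add: vec_eq_iff axis_def if_distrib cong: if_cong)
  moreover have "polynomial_function (\<lambda>x. \<Sum>i\<in>UNIV. (f x $ i * g x $ i) *\<^sub>R (axis i 1 :: real ^ 'm))"
    using polynomial_function_linear_compose[OF bounded_linear_vec_nth assms(1)]
      polynomial_function_linear_compose[OF bounded_linear_vec_nth assms(2)]
    by (intro polynomial_function_sum polynomial_function_mult)
      (auto simp: real_polynomial_function_eq[symmetric])
  ultimately show ?thesis by presburger
qed

section \<open>The splitting method\<close>

lemma inner_vec_times: "x \<bullet> (a * y) = y \<bullet> (a * (x :: real ^ 'm))"
  by (simp add: inner_vec_def mult_ac)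

lemma bounded_bilinear_vec_times: "bounded_bilinear ((*) :: real ^ 'm \<Rightarrow> real ^ 'm \<Rightarrow> real ^ 'm)"
  unfolding bilinear_conv_bounded_bilinear[symmetric] bilinear_def
  by (auto intro!: linearI simp: vec_eq_iff algebra_simps)

lemma diag_mult_vec: "diag u *v x = u * x"
  by (simp add: vec_eq_iff diag_def matrix_vector_mult_def if_distrib if_distribR cong: if_cong)

type_synonym 'm grid = "real ^ 'm"

text \<open>With D = \<open>Dplus h ** Dminus h\<close> and componentwise squares, this is the
  gradient in u of H(u, w) = \<tau>/2 (u . Du + w . Dw) + \<tau>/4 |u^2 + w^2|^2 - 1/2 g . (u^2 +
  w^2); swapping the arguments gives the gradient in w. The vector \<open>g\<close> stands for the
  noise \<open>G *v \<delta>\<close>.\<close>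

definition force ::
    "real \<Rightarrow> 'm::{finite,linorder} grid \<Rightarrow> real \<Rightarrow> 'm::{finite,linorder} grid \<Rightarrow> 'm::{finite,linorder} grid \<Rightarrow> 'm::{finite,linorder} grid"
  where
  "force h g \<tau> u w = \<tau> *\<^sub>R ((Dplus h ** Dminus h) *v u + (u * u + w * w) * u) - u * g"

definition force_derivative ::
    "real \<Rightarrow> 'm::{finite,linorder} grid \<Rightarrow> real \<Rightarrow> 'm::{finite,linorder} grid \<Rightarrow> 'm::{finite,linorder} grid \<Rightarrow>
      'm::{finite,linorder} grid \<Rightarrow> 'm::{finite,linorder} grid \<Rightarrow> 'm::{finite,linorder} grid"
  where
  "force_derivative h g \<tau> u w du dw =
     \<tau> *\<^sub>R ((Dplus h ** Dminus h) *v du + (3 * (u * u) + w * w) * du + (2 * (u * w)) * dw) - g * du"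

lemma has_derivative_force:
  assumes "(u has_derivative u') (at z)" "(w has_derivative w') (at z)"
  shows "((\<lambda>z. force h g \<tau> (u z) (w z)) has_derivative
    (\<lambda>v. force_derivative h g \<tau> (u z) (w z) (u' v) (w' v))) (at z)"
  unfolding force_def force_derivative_def
  apply (rule has_derivative_eq_rhs)
   apply (rule has_derivative_diff has_derivative_scaleR_right has_derivative_add
      bounded_bilinear.FDERIV[OF bounded_bilinear_vec_times]
      bounded_linear.has_derivative[OF matrix_vector_mul_bounded_linear] assms has_derivative_const)+
  apply (simp add: fun_eq_iff algebra_simps)
  done

text \<open>The field \<open>(u, w) \<mapsto> (force u w, force w u)\<close> is a gradient, so its derivative is symmetric.\<close>

lemma inner_force_derivative:
  "a \<bullet> force_derivative h g \<tau> u w c d + b \<bullet> force_derivative h g \<tau> w u d c =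
   c \<bullet> force_derivative h g \<tau> u w a b + d \<bullet> force_derivative h g \<tau> w u b a"
  unfolding force_derivative_def
  by (simp add: inner_right_distrib inner_diff_right inner_laplacian
      inner_vec_times[of a _ c] inner_vec_times[of b _ d] inner_vec_times[of a _ d] inner_vec_times[of b _ c]
      inner_commute[of "Dminus h *v a"] inner_commute[of "Dminus h *v b"] mult.commute[of w u] distrib_left)

lemma polynomial_function_force:
  fixes u w :: "'a::real_normed_vector \<Rightarrow> real ^ 'm::{finite,linorder}"
  assumes "polynomial_function u" "polynomial_function w"
  shows "polynomial_function (\<lambda>z. force h g \<tau> (u z) (w z))"
  unfolding force_def
  by (intro polynomial_function_diff polynomial_function_cmul polynomial_function_add
      polynomial_function_vec_times polynomial_function_const assms
      polynomial_function_linear_compose[OF matrix_vector_mul_bounded_linear])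

text \<open>All four updates of the two flows are one function up to sign and order of arguments, so
  a single symmetry statement serves both flows.\<close>

lemma Fa_eq:
  "Fa h G \<tau> \<delta> z = (fst z,
     fst (snd z) + force h (G *v \<delta>) \<tau> (snd (snd (snd z))) (fst z),
     fst (snd (snd z)) - force h (G *v \<delta>) \<tau> (fst z) (snd (snd (snd z))),
     snd (snd (snd z)))"
  by (cases z) (simp add: force_def matrix_vector_mult_add_rdistrib diag_mult_vec algebra_simps
      flip: matrix_vector_mul_assoc)

lemma Fb_eq:
  "Fb h G \<tau> \<delta> z = (fst z + force h (G *v \<delta>) \<tau> (fst (snd (snd z))) (fst (snd z)),
     fst (snd z),
     fst (snd (snd z)),
     snd (snd (snd z)) - force h (G *v \<delta>) \<tau> (fst (snd z)) (fst (snd (snd z))))"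
  by (cases z) (simp add: force_def matrix_vector_mult_add_rdistrib diag_mult_vec algebra_simps
      flip: matrix_vector_mul_assoc)

lemmas bounded_linear_projections =
  bounded_linear_fst
  bounded_linear_fst[THEN bounded_linear_compose, OF bounded_linear_snd]
  bounded_linear_fst[THEN bounded_linear_compose, OF bounded_linear_snd[THEN bounded_linear_compose, OF bounded_linear_snd]]
  bounded_linear_snd[THEN bounded_linear_compose, OF bounded_linear_snd[THEN bounded_linear_compose, OF bounded_linear_snd]]

lemma symplectic_map_Fa: "symplectic_map (Fa h G \<tau> \<delta>)"
  unfolding Fa_eq[abs_def]
  apply (rule symplectic_mapI)
   apply (rule has_derivative_Pair has_derivative_add has_derivative_diff has_derivative_force
     bounded_linear_projections[THEN bounded_linear_imp_has_derivative])+
  subgoal for z v w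
    using inner_force_derivative[of "fst v" h "G *v \<delta>" \<tau> "fst z" "snd (snd (snd z))" "fst w"
      "snd (snd (snd w))" "snd (snd (snd v))"]
    by (simp add: canonical_form_alt inner_diff_right inner_diff_left inner_right_distrib inner_left_distrib inner_commute)
  done

lemma symplectic_map_Fb: "symplectic_map (Fb h G \<tau> \<delta>)"
  unfolding Fb_eq[abs_def]
  apply (rule symplectic_mapI)
   apply (rule has_derivative_Pair has_derivative_add has_derivative_diff has_derivative_force
     bounded_linear_projections[THEN bounded_linear_imp_has_derivative])+
  subgoal for z v w
    using inner_force_derivative[of "fst (snd v)" h "G *v \<delta>" \<tau> "fst (snd z)" "fst (snd (snd z))"
      "fst (snd w)" "fst (snd (snd w))" "fst (snd (snd v))"]
    by (simp add: canonical_form_alt inner_diff_right inner_diff_left inner_right_distrib inner_left_distrib inner_commute)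
  done

lemma polynomial_function_Fa: "polynomial_function (Fa h G \<tau> \<delta>)"
  unfolding Fa_eq[abs_def]
  by (intro polynomial_function_Pair polynomial_function_add polynomial_function_diff
      polynomial_function_force bounded_linear_projections[THEN polynomial_function_bounded_linear])

lemma polynomial_function_Fb: "polynomial_function (Fb h G \<tau> \<delta>)"
  unfolding Fb_eq[abs_def]
  by (intro polynomial_function_Pair polynomial_function_add polynomial_function_diff
      polynomial_function_force bounded_linear_projections[THEN polynomial_function_bounded_linear])

lemma symplectic_integrator_splitting:
  fixes G :: "real ^ 'k ^ 'm::{finite,linorder}"
  shows "symplectic_integrator M N (splitting h G \<beta> dt)"
proof -
  have "polynomial_function (splitting h G \<beta> dt n \<omega>) \<and> symplectic_map (splitting h G \<beta> dt n \<omega>)" for n \<omega>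
  proof -
    have *: "polynomial_function (\<lambda>z. f (g z)) \<and> symplectic_map (\<lambda>z. f (g z))"
      if "polynomial_function f \<and> symplectic_map f" "polynomial_function g \<and> symplectic_map g"
      for f g :: "'m ext \<Rightarrow> 'm ext"
      using that polynomial_function_compose[of g f] symplectic_map_compose[of f g]
        differentiable_at_polynomial_function[of f] differentiable_at_polynomial_function[of g]
      unfolding o_def by blast
    note Fa = conjI[OF polynomial_function_Fa symplectic_map_Fa]
    note Fb = conjI[OF polynomial_function_Fb symplectic_map_Fb]
    show ?thesis
      unfolding splitting_def[abs_def] Let_def
      by (rule *[OF Fa *[OF Fb Fa]])
  qed
  then show ?thesis
    by (simp add: symplectic_integrator_def smooth_on_polynomial_function)
qed

section \<open>Symmetric projection\<close>

lemma adjoint_A_map: "adjoint A_map \<mu> = (fst \<mu>, - fst \<mu>, snd \<mu>, - snd \<mu>)"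
proof -
  have "adjoint A_map = (\<lambda>\<mu> :: 'a phase. (fst \<mu>, - fst \<mu>, snd \<mu>, - snd \<mu>))"
    by (rule adjoint_unique) (auto simp: inner_Pair inner_diff_left algebra_simps)
  then show ?thesis by simp
qed

text \<open>The step on (Q, P) alone. Reading off the first and third components loses nothing once
  the image lies in \<open>N_space\<close>.\<close>

definition phase_step :: "('m::finite ext \<Rightarrow> 'm ext) \<Rightarrow> ('m phase \<Rightarrow> 'm phase) \<Rightarrow> 'm phase \<Rightarrow> 'm phase" where
  "phase_step F lam u = (let Z = projected F u (lam u) in (fst Z, fst (snd (snd Z))))"

text \<open>The multiplier enters (Q, P) with plus and (X, Y) with minus, so the mixed terms cancel
  between the two summands of the form.\<close>

lemma canonical_form_projection:
  "canonical_form (dup u + adjoint A_map \<mu>) (dup v + adjoint A_map \<nu>) =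
   2 * (fst u \<bullet> snd v - fst v \<bullet> snd u) + 2 * (fst \<mu> \<bullet> snd \<nu> - fst \<nu> \<bullet> snd \<mu>)"
  by (cases u; cases v)
    (simp add: adjoint_A_map inner_diff_right inner_diff_left inner_right_distrib inner_left_distrib)

lemma bounded_linear_dup: "bounded_linear (dup :: 'm::finite phase \<Rightarrow> 'm ext)"
  unfolding linear_conv_bounded_linear[symmetric] by (rule linearI) auto

lemma bounded_linear_adjoint_A_map: "bounded_linear (adjoint (A_map :: 'm::finite ext \<Rightarrow> 'm phase))"
  unfolding linear_conv_bounded_linear[symmetric] by (rule linearI) (auto simp: adjoint_A_map)

text \<open>Pulled back along \<open>u \<mapsto> dup u + A\<^sup>T lam u\<close>, the extended form is twice \<open>dQ \<and> dP\<close> plus twice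
  the same expression in \<open>lam\<close>. The image under \<open>F\<close> is \<open>dup (phase_step F lam u) - A\<^sup>T lam u\<close>, whose
  multiplier part is the same, so it cancels.\<close>

lemma phase_step_symplectic:
  fixes F :: "'m::finite ext \<Rightarrow> 'm ext"
  assumes F: "symplectic_map F" "\<And>z. F differentiable (at z)"
    and lam: "local_multiplier F S lam" and u: "u \<in> S"
  obtains T where "(phase_step F lam has_derivative T) (at u)"
    and "\<And>v w. fst (T v) \<bullet> snd (T w) - fst (T w) \<bullet> snd (T v) = fst v \<bullet> snd w - fst w \<bullet> snd v"
proof -
  have S: "open S" and "smooth_on S lam"
    and N: "\<And>y. y \<in> S \<Longrightarrow> projected F y (lam y) \<in> N_space"
    using lam unfolding local_multiplier_def by blast+
  then have "ck_on (Suc 0) S lam" unfolding smooth_on_def by blast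
  then obtain l where l: "(lam has_derivative l) (at u)"
    using u by (auto simp: differentiable_def)
  define \<zeta> where "\<zeta> y = dup y + adjoint A_map (lam y)" for y
  define \<zeta>' where "\<zeta>' v = dup v + adjoint A_map (l v)" for v
  have d\<zeta>: "(\<zeta> has_derivative \<zeta>') (at u)"
    unfolding \<zeta>_def[abs_def] \<zeta>'_def[abs_def]
    by (intro has_derivative_add bounded_linear_imp_has_derivative[OF bounded_linear_dup]
        bounded_linear.has_derivative[OF bounded_linear_adjoint_A_map l])
  obtain F' where F': "(F has_derivative F') (at (\<zeta> u))"
    using F(2) unfolding differentiable_def by blast
  define Z where "Z v = F' (\<zeta>' v) + adjoint A_map (l v)" for v
  have dZ: "((\<lambda>y. projected F y (lam y)) has_derivative Z) (at u)"
    unfolding Z_def[abs_def] projected_def \<zeta>_def[symmetric]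
    by (intro has_derivative_add has_derivative_compose[OF d\<zeta> F']
        bounded_linear.has_derivative[OF bounded_linear_adjoint_A_map l])
  define T where "T v = (fst (Z v), fst (snd (snd (Z v))))" for v
  have dT: "(phase_step F lam has_derivative T) (at u)"
    unfolding phase_step_def[abs_def] Let_def T_def[abs_def]
    by (intro has_derivative_Pair has_derivative_fst has_derivative_snd dZ)
  \<comment> \<open>The constraint holds on the whole open set \<open>S\<close>, not only at
    \<open>u\<close>, so it may be differentiated: the derivative of the step also takes values in
    the range of \<open>dup\<close>.\<close>
  have "dup (phase_step F lam y) = projected F y (lam y)" if "y \<in> S" for y
    using N[OF that] by (cases "projected F y (lam y)") (auto simp: N_space_def phase_step_def zero_prod_def)
  then have "((\<lambda>y. projected F y (lam y)) has_derivative (\<lambda>v. dup (T v))) (at u)"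
    by (rule has_derivative_transform_within_open[OF
          bounded_linear.has_derivative[OF bounded_linear_dup dT] S u])
  then have "Z = (\<lambda>v. dup (T v))" by (rule has_derivative_unique[OF dZ])
  then have "F' (\<zeta>' v) + adjoint A_map (l v) = dup (T v)" for v
    unfolding Z_def by (rule fun_cong)
  moreover have "adjoint A_map (- l v) = - adjoint A_map (l v)" for v
    by (simp add: adjoint_A_map)
  ultimately have "F' (\<zeta>' v) = dup (T v) + adjoint A_map (- l v)" for v
    by (simp add: eq_diff_eq)
  then have eq: "canonical_form (dup (T v) + adjoint A_map (- l v)) (dup (T w) + adjoint A_map (- l w)) =
      canonical_form (\<zeta>' v) (\<zeta>' w)" for v w
    using symplectic_map_derivative[OF F(1) F'] by metis
  \<comment> \<open>The multiplier part is quadratic in \<open>l\<close>, so the sign of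
    \<open>- l\<close> drops out and this part cancels; dividing by 2 leaves dQ \<and> dP.\<close>
  have "fst (T v) \<bullet> snd (T w) - fst (T w) \<bullet> snd (T v) = fst v \<bullet> snd w - fst w \<bullet> snd v" for v w
    using eq[of v w] unfolding \<zeta>'_def canonical_form_projection by simp
  with dT show ?thesis by (rule that)
qed

section \<open>The conservation law along the numerical solution\<close>

lemma projection_step_initial_state:
  "projection_step h F lam (initial_state h u) = initial_state h (phase_step F lam u)"
  by (cases u) (simp add: phase_step_def Let_def)

lemma QP_initial_state [simp]: "QP (initial_state h u) = u"
  by (cases u) simp

text \<open>B and \<Theta> remain slaved to Q and P at every step, so the dynamics is that of the
  (Q, P) part.\<close>

lemma numerical_solution_initial_state:
  "numerical_solution h F lam n u = initial_state h (QP (numerical_solution h F lam n u))"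
  by (induction n) (simp, metis QP_initial_state numerical_solution.simps(2) projection_step_initial_state)

lemma QP_numerical_solution_Suc:
  "QP (numerical_solution h F lam (Suc n) u) =
   phase_step (F n) (lam n) (QP (numerical_solution h F lam n u))"
  by (metis QP_initial_state numerical_solution.simps(2) numerical_solution_initial_state projection_step_initial_state)

text \<open>All terms of the conservation law with factor \<open>dt\<close> vanish separately: \<open>dQ \<and> D\<^sup>+D\<^sup>-dQ = 0\<close> by symmetry
  of \<open>D\<^sup>+D\<^sup>-\<close>.\<close>

lemma multisymplectic_form_initial_state:
  assumes "(g has_derivative g') (at u)" "\<And>y. f y = initial_state h (g y)"
  shows "multisymplectic_form h dt f u v w =
    fst (g' v) \<bullet> snd (g' w) - fst (g' w) \<bullet> snd (g' v)"
proof -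
  have f: "f y = (fst (g y), snd (g y), Dminus h *v fst (g y), Dminus h *v snd (g y))" for y
    by (cases "g y") (simp add: assms(2))
  note d = has_derivative_fst[OF assms(1)] has_derivative_snd[OF assms(1)]
  show ?thesis
    unfolding multisymplectic_form_def Let_def wedge_inner mat_form_def f fst_conv snd_conv
      d[THEN extd_eq] d[THEN bounded_linear.has_derivative[OF matrix_vector_mul_bounded_linear], THEN extd_eq]
    by (simp add: inner_Dplus inner_commute)
qed

text \<open>Each multiplier branch is smooth only on its \<open>S k\<close>, so the chain rule needs
  every state that is stepped, those with k < n, to lie there.\<close>

lemma numerical_solution_differentiable:
  assumes F: "\<And>k. k < n \<Longrightarrow> symplectic_map (F k)" "\<And>k z. k < n \<Longrightarrow> F k differentiable (at z)"
    and lam: "\<And>k. k < n \<Longrightarrow> local_multiplier (F k) (S k) (lam k)"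
    and S: "\<And>k. k < n \<Longrightarrow> QP (numerical_solution h F lam k u) \<in> S k"
  shows "(\<lambda>y. QP (numerical_solution h F lam n y)) differentiable (at u)"
  using assms
proof (induction n)
  case 0
  then show ?case by simp
next
  case (Suc n)
  then have "(\<lambda>y. QP (numerical_solution h F lam n y)) differentiable (at u)" by simp
  then obtain g' where g': "((\<lambda>y. QP (numerical_solution h F lam n y)) has_derivative g') (at u)"
    unfolding differentiable_def by blast
  obtain T where "(phase_step (F n) (lam n) has_derivative T) (at (QP (numerical_solution h F lam n u)))"
    by (rule phase_step_symplectic[OF Suc.prems]) (rule lessI)+
  then show ?case
    unfolding QP_numerical_solution_Suc
    by (rule differentiableI[OF has_derivative_compose[OF g']])
qed

text \<open>The differential of the new (Q, P) is that of the old one followed by the symplectic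
  derivative of step \<open>n\<close>, taken at the state after \<open>n\<close> steps.\<close>

lemma multisymplectic_form_Suc:
  assumes F: "\<And>k. k \<le> n \<Longrightarrow> symplectic_map (F k)" "\<And>k z. k \<le> n \<Longrightarrow> F k differentiable (at z)"
    and lam: "\<And>k. k \<le> n \<Longrightarrow> local_multiplier (F k) (S k) (lam k)"
    and S: "\<And>k. k \<le> n \<Longrightarrow> QP (numerical_solution h F lam k u) \<in> S k"
  shows "multisymplectic_form h dt (numerical_solution h F lam (Suc n)) u v w =
         multisymplectic_form h dt (numerical_solution h F lam n) u v w"
proof -
  have "(\<lambda>y. QP (numerical_solution h F lam n y)) differentiable (at u)"
    using assms by (intro numerical_solution_differentiable[where S = S]) simp_all
  then obtain g' where g': "((\<lambda>y. QP (numerical_solution h F lam n y)) has_derivative g') (at u)"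
    by (auto simp: differentiable_def)
  obtain T where T: "(phase_step (F n) (lam n) has_derivative T) (at (QP (numerical_solution h F lam n u)))"
    and symp: "\<And>v w. fst (T v) \<bullet> snd (T w) - fst (T w) \<bullet> snd (T v) = fst v \<bullet> snd w - fst w \<bullet> snd v"
    using phase_step_symplectic[OF F lam S] by blast
  have "((\<lambda>y. QP (numerical_solution h F lam (Suc n) y)) has_derivative (\<lambda>v. T (g' v))) (at u)"
    unfolding QP_numerical_solution_Suc by (rule has_derivative_compose[OF g' T])
  from multisymplectic_form_initial_state[OF this numerical_solution_initial_state]
    multisymplectic_form_initial_state[OF g' numerical_solution_initial_state]
  show ?thesis by (simp only: symp)
qed

theorem theorem3p3:
  fixes M :: "'w measure"
    and \<beta> :: "'k::finite \<Rightarrow> real \<Rightarrow> 'w \<Rightarrow> real"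
    and e :: "'k \<Rightarrow> real \<Rightarrow> real"
    and ew :: "'k \<Rightarrow> real"
    and a b h T dt :: real
    and L N :: nat
    and G :: "real ^ 'k ^ 'm::{finite,linorder}"
  assumes "prob_space M"
    and "independent_brownian_motions M \<beta>"
    and "\<And>k. ew k \<ge> 0"
    and "a < b" and "L \<ge> 2" and "CARD('m) = L - 1" and "h = (b - a) / real L"
    and "T > 0" and "N \<ge> 1" and "dt = T / real N"
    and "G = E_mat a h e ** Lambda_mat ew"
  shows "(\<forall>(F :: nat \<Rightarrow> 'w \<Rightarrow> 'm ext \<Rightarrow> 'm ext)
           (S :: nat \<Rightarrow> 'w \<Rightarrow> 'm phase set) (lam :: nat \<Rightarrow> 'w \<Rightarrow> 'm phase \<Rightarrow> 'm phase).
           symplectic_integrator M N F \<longrightarrow>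
           (AE \<omega> in M. \<forall>n<N. local_multiplier (F n \<omega>) (S n \<omega>) (lam n \<omega>)) \<longrightarrow>
           (AE \<omega> in M. \<forall>n<N.
              let sol = numerical_solution h (\<lambda>k. F k \<omega>) (\<lambda>k. lam k \<omega>)
              in \<forall>u v w. (\<forall>k\<le>n. QP (sol k u) \<in> S k \<omega>) \<longrightarrow>
                   multisymplectic_form h dt (sol (Suc n)) u v w =
                   multisymplectic_form h dt (sol n) u v w))
         \<and> symplectic_integrator M N (splitting h G \<beta> dt)"
proof (intro conjI allI impI)
  fix F :: "nat \<Rightarrow> 'w \<Rightarrow> 'm ext \<Rightarrow> 'm ext"
    and S :: "nat \<Rightarrow> 'w \<Rightarrow> 'm phase set" and lam :: "nat \<Rightarrow> 'w \<Rightarrow> 'm phase \<Rightarrow> 'm phase"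
  assume F: "symplectic_integrator M N F"
    and lam: "AE \<omega> in M. \<forall>n<N. local_multiplier (F n \<omega>) (S n \<omega>) (lam n \<omega>)"
  have symp: "AE \<omega> in M. \<forall>n<N. symplectic_map (F n \<omega>)"
    using F by (simp add: symplectic_integrator_def)
  have diff: "F n \<omega> differentiable (at z)" if "n < N" "\<omega> \<in> space M" for n \<omega> z
  proof -
    have "ck_on (Suc 0) UNIV (F n \<omega>)"
      using F that unfolding symplectic_integrator_def smooth_on_def by blast
    then show ?thesis unfolding ck_on.simps by blast
  qed
  show "AE \<omega> in M. \<forall>n<N.
      let sol = numerical_solution h (\<lambda>k. F k \<omega>) (\<lambda>k. lam k \<omega>)
      in \<forall>u v w. (\<forall>k\<le>n. QP (sol k u) \<in> S k \<omega>) \<longrightarrow>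
           multisymplectic_form h dt (sol (Suc n)) u v w =
           multisymplectic_form h dt (sol n) u v w"
    \<comment> \<open>One exceptional null set serves all steps, initial values and tangent vectors:
      outside it the argument is deterministic.\<close>
    using AE_space symp lam
  proof eventually_elim
    case (elim \<omega>)
    then show ?case
      unfolding Let_def using diff
      by (intro allI impI multisymplectic_form_Suc[where S = "\<lambda>k. S k \<omega>"]) auto
  qed
next
  show "symplectic_integrator M N (splitting h G \<beta> dt)"
    by (rule symplectic_integrator_splitting)
qed

end
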